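(* A pair $(I,J)$ occurs as the pair of invariants $(I(f),J(f))$ of an integral ternary cubic form $f$ if and only if $(I,J)\in\frac1{16}\mathbb{Z}\times\frac1{32}\mathbb{Z}$, the pair $(16I,32J)$ satisfies one of the following conditions: (a) $16I\equiv0\pmod{16}$ and $32J\equiv0\pmod{32}$; (b) $16I\equiv0\pmod{16}$ and $32J\equiv8\pmod{32}$; (c) $16I\equiv1\pmod{64}$ and $32J\equiv31\pmod{32}$; (d) $16I\equiv9\pmod{64}$ and $32J\equiv27\pmod{32}$; (e) $16I\equiv17\pmod{64}$ and $32J\equiv7\pmod{32}$; (f) $16I\equiv25\pmod{64}$ and $32J\equiv3\pmod{32}$; (g) $16I\equiv33\pmod{64}$ and $32J\equiv15\pmod{32}$; (h) $16I\equiv41\pmod{64}$ and $32J\equiv11\pmod{32}$; (i) $16I\equiv49\pmod{64}$ and $32J\equiv23\pmod{32}$; (j) $16I\equiv57\pmod{64}$ and $32J\equiv19\pmod{32}$; and $(I,J)$ satisfies one of the following conditions: (a) $I\equiv0\pmod3$ and $J\equiv0\pmod{27}$; (b) $I\equiv1\pmod9$ and $J\equiv\pm2\pmod{27}$; (c) $I\equiv4\pmod9$ and $J\equiv\pm16\pmod{27}$; (d) $I\equiv7\pmod9$ and $J\equiv\pm7\pmod{27}$.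
   Context: An integral ternary cubic form is $f(x,y,z)=\sum_{i+j+k=3}a_{ijk}x^iy^jz^k$ with $a_{ijk}\in\mathbb{Z}$. The Hessian $\mathcal{H}(f)$ is the determinant of the matrix of second partial derivatives of $f$. $I(f),J(f)$ are the $\mathrm{SL}_3$-invariant polynomials of degrees $4$ and $6$ in the coefficients of $f$ determined by $\mathcal{H}(\mathcal{H}(f))=12288\,I(f)^2f+512\,J(f)\mathcal{H}(f)$, with sign normalized so that $x^3+Axz^2+Bz^3-y^2z$ has $I=-3A$, $J=-27B$. Since $I,J$ have denominators powers of $2$, the congruences modulo $3,9,27$ are understood in $\mathbb{Z}_{(3)}$ (i.e., after inverting $2$). *)

theory Defs
  imports "HOL-Analysis.Analysis" "HOL-Library.Poly_Mapping" "HOL-Number_Theory.Cong"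
begin

text \<open>
  Multivariate polynomials over \<open>'a\<close> with variables indexed by \<open>'v\<close> are finitely supported
  functions from monomials (finitely supported exponent vectors) to coefficients; the ring
  structure is the convolution product of \<open>Poly_Mapping\<close>.
\<close>

type_synonym 'v monomial = "'v \<Rightarrow>\<^sub>0 nat"
type_synonym ('v, 'a) mpolynomial = "'v monomial \<Rightarrow>\<^sub>0 'a"

definition mvar :: "'v \<Rightarrow> ('v, 'a::zero_neq_one) mpolynomial" where
  "mvar v = Poly_Mapping.single (Poly_Mapping.single v 1) 1"

definition mconst :: "'a::zero \<Rightarrow> ('v, 'a) mpolynomial" where
  "mconst c = Poly_Mapping.single 0 c"

definition monomial_degree :: "'v monomial \<Rightarrow> nat" where
  "monomial_degree m = (\<Sum>v\<in>Poly_Mapping.keys m. Poly_Mapping.lookup m v)"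

definition homogeneous :: "nat \<Rightarrow> ('v, 'a::zero) mpolynomial \<Rightarrow> bool" where
  "homogeneous d p \<longleftrightarrow> (\<forall>m\<in>Poly_Mapping.keys p. monomial_degree m = d)"

definition mpoly_vars :: "('v, 'a::zero) mpolynomial \<Rightarrow> 'v set" where
  "mpoly_vars p = (\<Union>m\<in>Poly_Mapping.keys p. Poly_Mapping.keys m)"

text \<open>
  Evaluation at \<open>s\<close>, with coefficients transported along \<open>h\<close>. With \<open>h = (\<lambda>c. c)\<close> this is
  evaluation in the coefficient ring, with \<open>h = mconst\<close> it is substitution of polynomials.
\<close>

definition mpoly_eval ::
  "('a::zero \<Rightarrow> 'b::comm_semiring_1) \<Rightarrow> ('v \<Rightarrow> 'b) \<Rightarrow> ('v, 'a) mpolynomial \<Rightarrow> 'b" where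
  "mpoly_eval h s p =
     (\<Sum>m\<in>Poly_Mapping.keys p. h (Poly_Mapping.lookup p m) *
        (\<Prod>v\<in>Poly_Mapping.keys m. s v ^ Poly_Mapping.lookup m v))"

text \<open>
  In the following, exponents are lowered with truncated subtraction; this is harmless because
  the coefficient vanishes when \<open>v\<close> does not occur in the monomial.
\<close>

definition pderivative :: "'v \<Rightarrow> ('v, 'a::comm_semiring_1) mpolynomial \<Rightarrow> ('v, 'a) mpolynomial" where
  "pderivative v p =
     (\<Sum>m\<in>Poly_Mapping.keys p.
        Poly_Mapping.single (m - Poly_Mapping.single v 1)
          (of_nat (Poly_Mapping.lookup m v) * Poly_Mapping.lookup p m))"

text \<open>The variables \<open>x, y, z\<close> are \<open>mvar 1, mvar 2, mvar 3\<close> over the three-element type \<open>3\<close>.\<close>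

definition ternary_cubic_form :: "(3, 'a::zero) mpolynomial \<Rightarrow> bool" where
  "ternary_cubic_form f \<longleftrightarrow> homogeneous 3 f"

definition hessian :: "(3, 'a::comm_ring_1) mpolynomial \<Rightarrow> (3, 'a) mpolynomial" where
  "hessian f = det (\<chi> i j. pderivative i (pderivative j f))"

text \<open>Linear change of variables: the \<open>v\<close>-th variable is replaced by the \<open>v\<close>-th entry of
  \<open>g (x, y, z)\<^sup>T\<close>.\<close>

definition linear_subst ::
  "'a::comm_ring_1 ^ 3 ^ 3 \<Rightarrow> (3, 'a) mpolynomial \<Rightarrow> (3, 'a) mpolynomial" where
  "linear_subst g f = mpoly_eval mconst (\<lambda>v. \<Sum>w\<in>UNIV. mconst (g $ v $ w) * mvar w) f"

text \<open>
  A polynomial in the coefficients \<open>a\<^sub>i\<^sub>j\<^sub>k\<close> of a ternary cubic form has the monomials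
  \<open>x\<^sup>i y\<^sup>j z\<^sup>k\<close> of degree 3 as indices of its variables; its value at a form \<open>f\<close> is
  obtained by plugging in the coefficients of \<open>f\<close>.
\<close>

type_synonym coeff_polynomial = "(3 monomial, rat) mpolynomial"

definition value_at :: "coeff_polynomial \<Rightarrow> (3, rat) mpolynomial \<Rightarrow> rat" where
  "value_at P f = mpoly_eval (\<lambda>c. c) (Poly_Mapping.lookup f) P"

definition SL3_invariant :: "nat \<Rightarrow> coeff_polynomial \<Rightarrow> bool" where
  "SL3_invariant d P \<longleftrightarrow>
     mpoly_vars P \<subseteq> {m. monomial_degree m = 3} \<and> homogeneous d P \<and>
     (\<forall>g f. det g = 1 \<longrightarrow> ternary_cubic_form f \<longrightarrow>
        value_at P (linear_subst g f) = value_at P f)"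

definition weierstrass_form :: "rat \<Rightarrow> rat \<Rightarrow> (3, rat) mpolynomial" where
  "weierstrass_form A B =
     mvar 1 ^ 3 + mconst A * mvar 1 * mvar 3 ^ 2 + mconst B * mvar 3 ^ 3 - mvar 2 ^ 2 * mvar 3"

text \<open>
  The relation determines \<open>J\<close>, and \<open>I\<close> up to sign; the last condition fixes the sign, so there is
  exactly one such pair of polynomials.
\<close>

definition ternary_cubic_invariants :: "coeff_polynomial \<Rightarrow> coeff_polynomial \<Rightarrow> bool" where
  "ternary_cubic_invariants inv_I inv_J \<longleftrightarrow>
     SL3_invariant 4 inv_I \<and> SL3_invariant 6 inv_J \<and>
     (\<forall>f. ternary_cubic_form f \<longrightarrow>
        hessian (hessian f) =
          mconst (12288 * (value_at inv_I f)\<^sup>2) * f + mconst (512 * value_at inv_J f) * hessian f) \<and>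
     (\<forall>A B. value_at inv_I (weierstrass_form A B) = - 3 * A \<and>
            value_at inv_J (weierstrass_form A B) = - 27 * B)"

abbreviation rational_form :: "(3, int) mpolynomial \<Rightarrow> (3, rat) mpolynomial" where
  "rational_form f \<equiv> Poly_Mapping.map rat_of_int f"

text \<open>Congruence modulo \<open>m\<close> in the localization of the integers at the prime 3: the difference is
  \<open>m\<close> times an element of that ring.\<close>

definition cong_at_3 :: "rat \<Rightarrow> rat \<Rightarrow> int \<Rightarrow> bool" where
  "cong_at_3 x y m \<longleftrightarrow>
     (\<exists>u v :: int. \<not> 3 dvd v \<and> x - y = rat_of_int m * (rat_of_int u / rat_of_int v))"

end

theory Submission
  imports Defs
begin

text \<open>
  Write \<open>16 I = c\<^sub>4\<close> and \<open>32 J = c\<^sub>6\<close>. Artin, Rodriguez-Villegas and Tate attach to a ternary cubic a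
  Weierstrass equation whose coefficients \<open>a\<^sub>1, a\<^sub>2, a\<^sub>3, a\<^sub>4, a\<^sub>6\<close> are integral polynomials in those of
  the cubic. Comparing only the coefficients of \<open>x\<^sup>3\<close> and \<open>y\<^sup>3\<close> in the Hessian relation already yields
  a linear system for \<open>I\<^sup>2\<close> and \<open>J\<close> with generically nonzero determinant, so \<open>16 I\<close> and \<open>32 J\<close> are the
  usual \<open>c\<^sub>4\<close> and \<open>c\<^sub>6\<close> of that equation, the sign of \<open>I\<close> being read off a Weierstrass cubic. A
  Weierstrass equation is itself a ternary cubic, hence the pairs in question are exactly the
  \<open>(c\<^sub>4, c\<^sub>6)\<close> of integral Weierstrass equations, which are characterised by Kraus' congruences at 2
  and 3.
\<close>

section \<open>Ternary cubic forms in coordinates\<close>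

text \<open>Monomials outside the support contribute zero. The freedom in \<open>S\<close> gives two
  polynomials and their sum, whose support may shrink by cancellation, a common range of
  summation.\<close>

lemma pderivative_sum:
  assumes "finite S" "Poly_Mapping.keys p \<subseteq> S"
  shows "pderivative v p =
    (\<Sum>m\<in>S. Poly_Mapping.single (m - Poly_Mapping.single v 1)
       (of_nat (Poly_Mapping.lookup m v) * Poly_Mapping.lookup p m))"
  unfolding pderivative_def
  by (rule sum.mono_neutral_left) (use assms in \<open>auto simp: in_keys_iff\<close>)

lemma pderivative_add: "pderivative v (p + q) = pderivative v p + pderivative v q"
proof -
  let ?S = "Poly_Mapping.keys p \<union> Poly_Mapping.keys q"
  have "finite ?S" "Poly_Mapping.keys (p + q) \<subseteq> ?S"
    by (simp_all add: keys_add)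
  then show ?thesis
    by (simp add: pderivative_sum[of ?S] lookup_add distrib_left single_add sum.distrib)
qed

lemma pderivative_single:
  "pderivative v (Poly_Mapping.single m c) =
     Poly_Mapping.single (m - Poly_Mapping.single v 1) (of_nat (Poly_Mapping.lookup m v) * c)"
  by (cases "c = 0") (simp_all add: pderivative_def)

lemma mconst_0: "mconst 0 = 0" by (simp add: mconst_def)
lemma mconst_add: "mconst (a + b) = mconst a + mconst b" by (simp add: mconst_def single_add)
lemma mconst_diff: "mconst (a - b) = mconst a - mconst b" for a b :: "'a::ab_group_add"
  by (simp add: mconst_def single_diff)
lemma mconst_uminus: "mconst (- a) = - mconst a" for a :: "'a::ab_group_add"
  by (simp add: mconst_def single_uminus)
lemma mconst_mult: "mconst (a * b) = mconst a * mconst b" by (simp add: mconst_def mult_single)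
lemma mconst_1: "mconst 1 = 1" by (simp add: mconst_def)
lemma mconst_numeral: "mconst (numeral n) = numeral n" by (simp add: mconst_def single_numeral)
lemma mconst_power: "mconst (a ^ n) = mconst a ^ n"
  by (induction n) (simp_all add: mconst_1 mconst_mult)

lemma mvar_power: "mvar v ^ n = Poly_Mapping.single (Poly_Mapping.single v n) (1 :: 'a::comm_semiring_1)"
  by (induction n) (simp_all add: mvar_def mult_single single_add[symmetric])

definition tmono :: "nat \<Rightarrow> nat \<Rightarrow> nat \<Rightarrow> 3 monomial" where
  "tmono i j k = Poly_Mapping.single 1 i + Poly_Mapping.single 2 j + Poly_Mapping.single 3 k"

lemma lookup_tmono: "Poly_Mapping.lookup (tmono i j k) 1 = i" "Poly_Mapping.lookup (tmono i j k) 2 = j"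
  "Poly_Mapping.lookup (tmono i j k) 3 = k"
  by (simp_all add: tmono_def lookup_add lookup_single)

lemma tmono_eq_iff: "tmono i j k = tmono i' j' k' \<longleftrightarrow> i = i' \<and> j = j' \<and> k = k'"
  by (metis lookup_tmono)

lemma tmono_lookup: "tmono (Poly_Mapping.lookup m 1) (Poly_Mapping.lookup m 2) (Poly_Mapping.lookup m 3) = m"
proof (rule poly_mapping_eqI)
  fix v :: 3
  have "v = 1 \<or> v = 2 \<or> v = 3" by (rule exhaust_3)
  then show "Poly_Mapping.lookup (tmono (Poly_Mapping.lookup m 1) (Poly_Mapping.lookup m 2)
      (Poly_Mapping.lookup m 3)) v = Poly_Mapping.lookup m v"
    using lookup_tmono by fastforce
qed

lemma monomial_degree_tmono: "monomial_degree (tmono i j k) = i + j + k"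
proof -
  have "monomial_degree m = (\<Sum>v\<in>UNIV. Poly_Mapping.lookup m v)" for m :: "3 monomial"
    unfolding monomial_degree_def by (rule sum.mono_neutral_left) (auto simp: in_keys_iff)
  then show ?thesis by (simp add: sum_3 lookup_tmono)
qed

definition tterm :: "'a::zero \<Rightarrow> nat \<Rightarrow> nat \<Rightarrow> nat \<Rightarrow> (3, 'a) mpolynomial" where
  "tterm c i j k = Poly_Mapping.single (tmono i j k) c"

lemma tterm_eq: "tterm c i j k = mconst c * mvar 1 ^ i * mvar 2 ^ j * mvar 3 ^ k"
  for c :: "'a::comm_semiring_1"
  by (simp add: tterm_def mconst_def mvar_power mult_single tmono_def)

lemma tmono_minus:
  "tmono i j k - Poly_Mapping.single 1 1 = tmono (i - 1) j k"
  "tmono i j k - Poly_Mapping.single 2 1 = tmono i (j - 1) k"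
  "tmono i j k - Poly_Mapping.single 3 1 = tmono i j (k - 1)"
  by (rule trans[OF tmono_lookup[symmetric]], simp add: tmono_eq_iff lookup_minus lookup_tmono lookup_single)+

lemma pderivative_tterm:
  "pderivative 1 (tterm c i j k) = tterm (of_nat i * c) (i - 1) j k"
  "pderivative 2 (tterm c i j k) = tterm (of_nat j * c) i (j - 1) k"
  "pderivative 3 (tterm c i j k) = tterm (of_nat k * c) i j (k - 1)"
  by (simp_all only: tterm_def pderivative_single tmono_minus lookup_tmono)

text \<open>The coefficients of \<open>x\<^sup>3, y\<^sup>3, z\<^sup>3, x\<^sup>2y, x\<^sup>2z, xy\<^sup>2, y\<^sup>2z, xz\<^sup>2, yz\<^sup>2, xyz\<close>, in this order.\<close>

definition cubic_form :: "'a::monoid_add \<Rightarrow> 'a \<Rightarrow> 'a \<Rightarrow> 'a \<Rightarrow> 'a \<Rightarrow> 'a \<Rightarrow> 'a \<Rightarrow> 'a \<Rightarrow> 'a \<Rightarrow> 'a \<Rightarrow> (3, 'a) mpolynomial" where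
  "cubic_form a b c a2 a3 b1 b3 c1 c2 m =
     tterm a 3 0 0 + tterm b 0 3 0 + tterm c 0 0 3 + tterm a2 2 1 0 + tterm a3 2 0 1 +
     tterm b1 1 2 0 + tterm b3 0 2 1 + tterm c1 1 0 2 + tterm c2 0 1 2 + tterm m 1 1 1"

definition linear_form where
  "linear_form p q r = tterm p 1 0 0 + tterm q 0 1 0 + tterm r 0 0 1"

lemma tterm_0: "tterm 0 i j k = 0"
  by (simp add: tterm_def)

lemma pderivative_cubic_form:
  fixes a b c a2 a3 b1 b3 c1 c2 m :: "'a::idom"
  defines "f \<equiv> cubic_form a b c a2 a3 b1 b3 c1 c2 m"
  shows "pderivative 1 (pderivative 1 f) = linear_form (6 * a) (2 * a2) (2 * a3)"
    "pderivative 1 (pderivative 2 f) = linear_form (2 * a2) (2 * b1) m"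
    "pderivative 1 (pderivative 3 f) = linear_form (2 * a3) m (2 * c1)"
    "pderivative 2 (pderivative 1 f) = linear_form (2 * a2) (2 * b1) m"
    "pderivative 2 (pderivative 2 f) = linear_form (2 * b1) (6 * b) (2 * b3)"
    "pderivative 2 (pderivative 3 f) = linear_form m (2 * b3) (2 * c2)"
    "pderivative 3 (pderivative 1 f) = linear_form (2 * a3) m (2 * c1)"
    "pderivative 3 (pderivative 2 f) = linear_form m (2 * b3) (2 * c2)"
    "pderivative 3 (pderivative 3 f) = linear_form (2 * c1) (2 * c2) (6 * c)"
  by (simp_all add: f_def cubic_form_def linear_form_def pderivative_add pderivative_tterm tterm_0)

text \<open>The second partials of a cubic are linear forms, so the determinant is a cubic again and
  the formula can be applied to its own output. Once everything is written through
  \<open>mconst\<close> and \<open>mvar\<close>, the claim is a polynomial identity in a commutative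
  ring.\<close>

lemma hessian_cubic_form:
  fixes a b c a2 a3 b1 b3 c1 c2 m :: "'a::idom"
  shows "hessian (cubic_form a b c a2 a3 b1 b3 c1 c2 m) = cubic_form
    (24 * a * b1 * c1 - 6 * a * m ^ 2 - 8 * a2 ^ 2 * c1 + 8 * a2 * a3 * m - 8 * a3 ^ 2 * b1)
    (24 * b * a2 * c2 - 6 * b * m ^ 2 - 8 * a2 * b3 ^ 2 - 8 * b1 ^ 2 * c2 + 8 * b1 * b3 * m)
    (24 * c * a3 * b3 - 6 * c * m ^ 2 - 8 * a3 * c2 ^ 2 - 8 * b3 * c1 ^ 2 + 8 * c1 * c2 * m)
    (72 * a * b * c1 + 24 * a * b1 * c2 - 24 * a * b3 * m - 24 * b * a3 ^ 2 - 8 * a2 ^ 2 * c2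
      + 16 * a2 * a3 * b3 - 8 * a2 * b1 * c1 + 2 * a2 * m ^ 2)
    (72 * a * c * b1 + 24 * a * b3 * c1 - 24 * a * c2 * m - 24 * c * a2 ^ 2 + 16 * a2 * a3 * c2
      - 8 * a3 ^ 2 * b3 - 8 * a3 * b1 * c1 + 2 * a3 * m ^ 2)
    (72 * a * b * c2 - 24 * a * b3 ^ 2 + 24 * b * a2 * c1 - 24 * b * a3 * m - 8 * a2 * b1 * c2
      + 16 * a3 * b1 * b3 - 8 * b1 ^ 2 * c1 + 2 * b1 * m ^ 2)
    (72 * b * c * a2 + 24 * b * a3 * c2 - 24 * b * c1 * m - 24 * c * b1 ^ 2 - 8 * a2 * b3 * c2
      - 8 * a3 * b3 ^ 2 + 16 * b1 * b3 * c1 + 2 * b3 * m ^ 2)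
    (72 * a * c * b3 - 24 * a * c2 ^ 2 - 24 * c * a2 * m + 24 * c * a3 * b1 + 16 * a2 * c1 * c2
      - 8 * a3 * b3 * c1 - 8 * b1 * c1 ^ 2 + 2 * c1 * m ^ 2)
    (72 * b * c * a3 - 24 * b * c1 ^ 2 + 24 * c * a2 * b3 - 24 * c * b1 * m - 8 * a2 * c2 ^ 2
      - 8 * a3 * b3 * c2 + 16 * b1 * c1 * c2 + 2 * c2 * m ^ 2)
    (216 * a * b * c - 24 * a * b3 * c2 - 24 * b * a3 * c1 - 24 * c * a2 * b1
      + 24 * a2 * b3 * c1 - 8 * a2 * c2 * m + 24 * a3 * b1 * c2 - 8 * a3 * b3 * m
        - 8 * b1 * c1 * m + 2 * m ^ 3)"
  unfolding hessian_def det_3 vec_lambda_beta pderivative_cubic_form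
  unfolding cubic_form_def linear_form_def tterm_eq mconst_add mconst_diff mconst_mult mconst_power mconst_numeral
    power_0 mult_1_right power_one_right
  by algebra

section \<open>Coefficients and normal form of a ternary cubic\<close>

definition coef :: "(3, 'a::zero) mpolynomial \<Rightarrow> nat \<Rightarrow> nat \<Rightarrow> nat \<Rightarrow> 'a" where
  "coef f i j k = Poly_Mapping.lookup f (tmono i j k)"

lemma coef_cubic_form:
  fixes a b c a2 a3 b1 b3 c1 c2 m :: "'a::monoid_add"
  defines "f \<equiv> cubic_form a b c a2 a3 b1 b3 c1 c2 m"
  shows "coef f 3 0 0 = a" "coef f 0 3 0 = b" "coef f 0 0 3 = c" "coef f 2 1 0 = a2"
    "coef f 2 0 1 = a3" "coef f 1 2 0 = b1" "coef f 0 2 1 = b3" "coef f 1 0 2 = c1"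
    "coef f 0 1 2 = c2" "coef f 1 1 1 = m"
  by (simp_all add: f_def cubic_form_def coef_def tterm_def lookup_add lookup_single tmono_eq_iff when_def)

lemma ternary_cubic_form_add:
  "ternary_cubic_form f \<Longrightarrow> ternary_cubic_form g \<Longrightarrow> ternary_cubic_form (f + g)"
  unfolding ternary_cubic_form_def homogeneous_def using keys_add[of f g] by blast

lemma ternary_cubic_form_tterm: "i + j + k = 3 \<Longrightarrow> ternary_cubic_form (tterm c i j k)"
  by (simp add: ternary_cubic_form_def homogeneous_def tterm_def monomial_degree_tmono)

lemma ternary_cubic_form_cubic_form: "ternary_cubic_form (cubic_form a b c a2 a3 b1 b3 c1 c2 m)"
  unfolding cubic_form_def by (intro ternary_cubic_form_add ternary_cubic_form_tterm) simp_all

lemma coef_eq_0: "ternary_cubic_form f \<Longrightarrow> i + j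
  + k \<noteq> 3 \<Longrightarrow> coef f i j k = 0"
  unfolding ternary_cubic_form_def homogeneous_def coef_def
  by (metis in_keys_iff monomial_degree_tmono)

lemma ternary_cubic_form_eq:
  fixes f :: "(3, 'a::monoid_add) mpolynomial"
  assumes "ternary_cubic_form f"
  shows "f = cubic_form (coef f 3 0 0) (coef f 0 3 0) (coef f 0 0 3) (coef f 2 1 0) (coef f 2 0 1)
    (coef f 1 2 0) (coef f 0 2 1) (coef f 1 0 2) (coef f 0 1 2) (coef f 1 1 1)" (is "f = ?g")
proof (rule poly_mapping_eqI)
  fix m
  have "coef f i j k = coef ?g i j k" for i j k
  proof (cases "i + j + k = 3")
    case True
    then have k: "k = 3 - i - j" "i + j \<le> 3" by simp_all
    then have "i \<in> {..3}" "j \<in> {..3}" by simp_all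
    then have "i \<in> {0, 1, 2, 3}" "j \<in> {0, 1, 2, 3}" by auto
    with k(2) show ?thesis unfolding k(1) by (auto simp: coef_cubic_form[unfolded One_nat_def])
  qed (simp add: coef_eq_0 assms ternary_cubic_form_cubic_form)
  then show "Poly_Mapping.lookup f m = Poly_Mapping.lookup ?g m"
    unfolding coef_def by (metis tmono_lookup)
qed

lemma ternary_cubic_form_cases:
  fixes f :: "(3, 'a::monoid_add) mpolynomial"
  assumes "ternary_cubic_form f"
  obtains a b c a2 a3 b1 b3 c1 c2 m where "f = cubic_form a b c a2 a3 b1 b3 c1 c2 m"
  using ternary_cubic_form_eq[OF assms] by blast

section \<open>The Jacobian and the Hessian relation\<close>

text \<open>In the usual notation \<open>c\<^sub>4 = b\<^sub>2\<^sup>2 - 24 b\<^sub>4\<close> and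
  \<open>c\<^sub>6 = - b\<^sub>2\<^sup>3 + 36 b\<^sub>2 b\<^sub>4 - 216 b\<^sub>6\<close>, where
  \<open>b\<^sub>2 = a\<^sub>1\<^sup>2 + 4 a\<^sub>2\<close>,
  \<open>b\<^sub>4 = 2 a\<^sub>4 + a\<^sub>1 a\<^sub>3\<close> and
  \<open>b\<^sub>6 = a\<^sub>3\<^sup>2 + 4 a\<^sub>6\<close>.\<close>

definition weierstrass_c4 :: "'a::comm_ring_1 \<Rightarrow> 'a \<Rightarrow> 'a \<Rightarrow> 'a \<Rightarrow> 'a" where
  "weierstrass_c4 a1 a2 a3 a4 = (a1 ^ 2 + 4 * a2) ^ 2 - 24 * (2 * a4 + a1 * a3)"

definition weierstrass_c6 :: "'a::comm_ring_1 \<Rightarrow> 'a \<Rightarrow> 'a \<Rightarrow> 'a \<Rightarrow> 'a \<Rightarrow> 'a" where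
  "weierstrass_c6 a1 a2 a3 a4 a6 = - ((a1 ^ 2 + 4 * a2) ^ 3)
     + 36 * (a1 ^ 2 + 4 * a2) * (2 * a4 + a1 * a3) - 216 * (a3 ^ 2 + 4 * a6)"

text \<open>
  The Weierstrass coefficients of the Jacobian given by Artin, Rodriguez-Villegas and Tate; the
  remaining one is \<open>a\<^sub>1 = m\<close>.
\<close>

definition jacobian_a2 :: "'a::comm_ring_1 \<Rightarrow> 'a \<Rightarrow> 'a \<Rightarrow> 'a \<Rightarrow> 'a \<Rightarrow> 'a \<Rightarrow> 'a \<Rightarrow> 'a \<Rightarrow> 'a \<Rightarrow> 'a \<Rightarrow> 'a" where
  "jacobian_a2 a b c a2 a3 b1 b3 c1 c2 m =
     - (a2 * c2 + a3 * b3 + b1 * c1)"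

definition jacobian_a3 :: "'a::comm_ring_1 \<Rightarrow> 'a \<Rightarrow> 'a \<Rightarrow> 'a \<Rightarrow> 'a \<Rightarrow> 'a \<Rightarrow> 'a \<Rightarrow> 'a \<Rightarrow> 'a \<Rightarrow> 'a \<Rightarrow> 'a" where
  "jacobian_a3 a b c a2 a3 b1 b3 c1 c2 m =
     9 * a * b * c - (a * b3 * c2 + b * a3 * c1 + c * a2 * b1) - (a2 * b3 * c1 + a3 * b1 * c2)"

definition jacobian_a4 :: "'a::comm_ring_1 \<Rightarrow> 'a \<Rightarrow> 'a \<Rightarrow> 'a \<Rightarrow> 'a \<Rightarrow> 'a \<Rightarrow> 'a \<Rightarrow> 'a \<Rightarrow> 'a \<Rightarrow> 'a \<Rightarrow> 'a" where
  "jacobian_a4 a b c a2 a3 b1 b3 c1 c2 m =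
     - 3 * (a * b * c1 * c2 + a * c * b1 * b3 + b * c * a2 * a3) + a * (b1 * c2^2 + b3^2 * c1)
     + b * (a2 * c1^2 + a3^2 * c2) + c * (a2^2 * b3 + a3 * b1^2) + a2 * c2 * a3 * b3
     + b1 * c1 * a2 * c2 + a3 * b3 * b1 * c1"

definition jacobian_a6 :: "'a::comm_ring_1 \<Rightarrow> 'a \<Rightarrow> 'a \<Rightarrow> 'a \<Rightarrow> 'a \<Rightarrow> 'a \<Rightarrow> 'a \<Rightarrow> 'a \<Rightarrow> 'a \<Rightarrow> 'a \<Rightarrow> 'a" where
  "jacobian_a6 a b c a2 a3 b1 b3 c1 c2 m =
     - a2 * a3 * b1 * b3 * c1 * c2 - c * a3 ^ 2 * b1 ^ 2 * b3 + c * a2 * a3 * b1 * b3 * m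
     - c * a2 * a3 * b1 ^ 2 * c2 - c * a2 ^ 2 * b1 * b3 * c1 - c * a2 ^ 2 * a3 * b3 ^ 2
     - b * a3 ^ 2 * b1 * c1 * c2 + b * a2 * a3 * c1 * c2 * m - b * a2 * a3 * b3 * c1 ^ 2
     - b * a2 * a3 ^ 2 * c2 ^ 2 - b * a2 ^ 2 * c1 ^ 2 * c2 + b * c * a3 ^ 2 * b1 * m
     - b * c * a2 * a3 * m ^ 2 - b * c * a2 * a3 * b1 * c1 + 2 * b * c * a2 * a3 ^ 2 * b3
     + b * c * a2 ^ 2 * c1 * m + 2 * b * c * a2 ^ 2 * a3 * c2 - b * c ^ 2 * a2 ^ 3
     - b ^ 2 * c * a3 ^ 3 + a * b1 * b3 * c1 * c2 * m - a * b1 * b3 ^ 2 * c1 ^ 2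
     - a * b1 ^ 2 * c1 * c2 ^ 2 - a * a3 * b1 * b3 * c2 ^ 2 - a * a2 * b3 ^ 2 * c1 * c2
     - a * c * b1 * b3 * m ^ 2 + a * c * b1 ^ 2 * c2 * m + 2 * a * c * b1 ^ 2 * b3 * c1
     + 2 * a * c * a3 * b1 * b3 ^ 2 + a * c * a2 * b3 ^ 2 * m - a * c * a2 * b1 * b3 * c2
     - a * c ^ 2 * b1 ^ 3 - a * b * c1 * c2 * m ^ 2 + a * b * b3 * c1 ^ 2 * m
     + 2 * a * b * b1 * c1 ^ 2 * c2 + a * b * a3 * c2 ^ 2 * m - a * b * a3 * b3 * c1 * c2
     + 2 * a * b * a2 * c1 * c2 ^ 2 + a * b * c * m ^ 3 - 3 * a * b * c * b1 * c1 * m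
     - 3 * a * b * c * a3 * b3 * m + 3 * a * b * c * a3 * b1 * c2 - 3 * a * b * c * a2 * c2 * m
     + 3 * a * b * c * a2 * b3 * c1 + 9 * a * b * c ^ 2 * a2 * b1 - a * b ^ 2 * c1 ^ 3
     + 9 * a * b ^ 2 * c * a3 * c1 - a ^ 2 * c * b3 ^ 3 - a ^ 2 * b * c2 ^ 3
     + 9 * a ^ 2 * b * c * b3 * c2 - 27 * a ^ 2 * b ^ 2 * c ^ 2"

definition jacobian_c4 :: "(3, 'a::comm_ring_1) mpolynomial \<Rightarrow> 'a" where
  "jacobian_c4 f =
     (let v = (\<lambda>F. F (coef f 3 0 0) (coef f 0 3 0) (coef f 0 0 3) (coef f 2 1 0) (coef f 2 0 1)
       (coef f 1 2 0) (coef f 0 2 1) (coef f 1 0 2) (coef f 0 1 2) (coef f 1 1 1)) in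
     weierstrass_c4 (coef f 1 1 1) (v jacobian_a2) (v jacobian_a3) (v jacobian_a4))"

definition jacobian_c6 :: "(3, 'a::comm_ring_1) mpolynomial \<Rightarrow> 'a" where
  "jacobian_c6 f =
     (let v = (\<lambda>F. F (coef f 3 0 0) (coef f 0 3 0) (coef f 0 0 3) (coef f 2 1 0) (coef f 2 0 1)
       (coef f 1 2 0) (coef f 0 2 1) (coef f 1 0 2) (coef f 0 1 2) (coef f 1 1 1)) in
     weierstrass_c6 (coef f 1 1 1) (v jacobian_a2) (v jacobian_a3) (v jacobian_a4) (v jacobian_a6))"

lemmas jacobian_defs = jacobian_c4_def jacobian_c6_def weierstrass_c4_def weierstrass_c6_def
  jacobian_a2_def jacobian_a3_def jacobian_a4_def jacobian_a6_def Let_def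

lemma coef_hessian:
  fixes f :: "(3, 'a::idom) mpolynomial"
  assumes "ternary_cubic_form f"
  shows "coef (hessian f) 3 0 0 =
     24 * coef f 3 0 0 * coef f 1 2 0 * coef f 1 0 2 - 6 * coef f 3 0 0 * coef f 1 1 1 ^ 2
     - 8 * coef f 2 1 0 ^ 2 * coef f 1 0 2 + 8 * coef f 2 1 0 * coef f 2 0 1 * coef f 1 1 1
     - 8 * coef f 2 0 1 ^ 2 * coef f 1 2 0"
    "coef (hessian f) 0 3 0 =
     24 * coef f 0 3 0 * coef f 2 1 0 * coef f 0 1 2 - 6 * coef f 0 3 0 * coef f 1 1 1 ^ 2
     - 8 * coef f 2 1 0 * coef f 0 2 1 ^ 2 - 8 * coef f 1 2 0 ^ 2 * coef f 0 1 2
     + 8 * coef f 1 2 0 * coef f 0 2 1 * coef f 1 1 1"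
  using assms
  by (auto elim!: ternary_cubic_form_cases simp only: hessian_cubic_form coef_cubic_form)

text \<open>This is the Hessian relation rescaled: 12288 = 48 * 16^2 and 512 = 16 * 32. Both
  equations are identities in the ten coefficients.\<close>

lemma hessian_hessian_coef:
  fixes f :: "(3, 'a::idom) mpolynomial"
  assumes "ternary_cubic_form f"
  shows "coef (hessian (hessian f)) 3 0 0 =
      48 * jacobian_c4 f ^ 2 * coef f 3 0 0 + 16 * jacobian_c6 f * coef (hessian f) 3 0 0" (is ?x)
    and "coef (hessian (hessian f)) 0 3 0 =
      48 * jacobian_c4 f ^ 2 * coef f 0 3 0 + 16 * jacobian_c6 f * coef (hessian f) 0 3 0" (is ?y)
proof -
  obtain a b c a2 a3 b1 b3 c1 c2 m where f: "f = cubic_form a b c a2 a3 b1 b3 c1 c2 m"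
    using assms by (rule ternary_cubic_form_cases)
  show ?x unfolding f hessian_cubic_form coef_cubic_form jacobian_defs by algebra
  show ?y unfolding f hessian_cubic_form coef_cubic_form jacobian_defs by algebra
qed

section \<open>Integral forms viewed over the rationals\<close>

lemma rational_form_cubic: "ternary_cubic_form f \<Longrightarrow> ternary_cubic_form (rational_form f)"
  by (auto simp: ternary_cubic_form_def homogeneous_def in_keys_iff map.rep_eq when_def split: if_splits)

lemma coef_rational_form: "coef (rational_form f) i j k = rat_of_int (coef f i j k)"
  by (simp add: coef_def map.rep_eq when_def)

lemma jacobian_rational_form:
  "jacobian_c4 (rational_form f) = rat_of_int (jacobian_c4 f)"
  "jacobian_c6 (rational_form f) = rat_of_int (jacobian_c6 f)"
  by (simp_all add: jacobian_defs coef_rational_form)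

lemma weierstrass_form_eq: "weierstrass_form A B = cubic_form 1 0 B 0 0 0 (- 1) A 0 0"
  by (simp add: weierstrass_form_def cubic_form_def tterm_eq mconst_0 mconst_1 mconst_uminus algebra_simps)

text \<open>Polynomiality along affine lines replaces polynomiality in the ten coefficients: it suffices to
  cancel a factor that does not vanish identically.\<close>

definition poly_fun :: "((3, 'a::idom) mpolynomial \<Rightarrow> 'a) \<Rightarrow> bool" where
  "poly_fun F \<longleftrightarrow> (\<forall>f g. \<exists>p. \<forall>t. F (f + mconst t * g) = poly p t)"

lemma lookup_mconst_mult: "Poly_Mapping.lookup (mconst c * f) m = c * Poly_Mapping.lookup f m"
  for c :: "'a::comm_semiring_1"
  unfolding mconst_def mult_map_scale_conv_mult[symmetric] by (simp add: map.rep_eq when_def)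

lemma poly_fun_const: "poly_fun (\<lambda>f. c)"
  unfolding poly_fun_def by (metis poly_pCons poly_0 add.right_neutral mult_zero_right)

lemma poly_fun_add: "poly_fun F \<Longrightarrow> poly_fun G \<Longrightarrow> poly_fun (\<lambda>f. F f + G f)"
  unfolding poly_fun_def by (metis poly_add)

lemma poly_fun_uminus: "poly_fun F \<Longrightarrow> poly_fun (\<lambda>f. - F f)"
  unfolding poly_fun_def by (metis poly_minus)

lemma poly_fun_diff: "poly_fun F \<Longrightarrow> poly_fun G \<Longrightarrow> poly_fun (\<lambda>f. F f - G f)"
  unfolding poly_fun_def by (metis poly_diff)

lemma poly_fun_mult: "poly_fun F \<Longrightarrow> poly_fun G \<Longrightarrow> poly_fun (\<lambda>f. F f * G f)"
  unfolding poly_fun_def by (metis poly_mult)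

lemma poly_fun_power: "poly_fun F \<Longrightarrow> poly_fun (\<lambda>f. F f ^ n)"
  unfolding poly_fun_def by (metis poly_power)

lemma poly_fun_sum: "(\<And>i. i \<in> S \<Longrightarrow> poly_fun (F i)) \<Longrightarrow> poly_fun (\<lambda>f. \<Sum>i\<in>S. F i f)"
  by (induction S rule: infinite_finite_induct) (simp_all add: poly_fun_const poly_fun_add)

lemma poly_fun_prod: "(\<And>i. i \<in> S \<Longrightarrow> poly_fun (F i)) \<Longrightarrow> poly_fun (\<lambda>f. \<Prod>i\<in>S. F i f)"
  by (induction S rule: infinite_finite_induct) (simp_all add: poly_fun_const poly_fun_mult)

lemma poly_fun_lookup: "poly_fun (\<lambda>f. Poly_Mapping.lookup f m)"
  unfolding poly_fun_def
proof (intro allI exI)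
  fix f g :: "(3, 'a) mpolynomial" and t
  show "Poly_Mapping.lookup (f + mconst t * g) m =
      poly [:Poly_Mapping.lookup f m, Poly_Mapping.lookup g m:] t"
    by (simp add: lookup_add lookup_mconst_mult)
qed

lemmas poly_fun_intros = poly_fun_const poly_fun_add poly_fun_uminus poly_fun_diff poly_fun_mult
  poly_fun_power poly_fun_sum poly_fun_prod poly_fun_lookup

lemma poly_fun_value_at: "poly_fun (value_at P)"
  unfolding value_at_def[abs_def] mpoly_eval_def by (intro poly_fun_intros)

lemma poly_fun_jacobian: "poly_fun jacobian_c4" "poly_fun jacobian_c6"
  unfolding jacobian_defs[abs_def] coef_def by (intro poly_fun_intros)+

lemma ternary_cubic_form_mconst_mult:
  "ternary_cubic_form f \<Longrightarrow> ternary_cubic_form (mconst c * f)" for c :: "'a::comm_semiring_1"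
  by (auto simp: ternary_cubic_form_def homogeneous_def in_keys_iff lookup_mconst_mult)

text \<open>On the line from \<open>g\<close> at t = 0 to \<open>f\<close> at t = 1 both functions
  are polynomials in t, and their product vanishes at every t. In characteristic zero the product is
  then the zero polynomial; the factor from \<open>F\<close> is nonzero at t = 1, so the one from
  \<open>G\<close> is zero.\<close>

lemma poly_fun_cancel:
  fixes F G :: "(3, 'a::{idom, ring_char_0}) mpolynomial \<Rightarrow> 'a"
  assumes "poly_fun F" "poly_fun G" and FG: "\<And>f. ternary_cubic_form f \<Longrightarrow> F f * G f = 0"
    and f: "ternary_cubic_form f" "F f \<noteq> 0" and g: "ternary_cubic_form g"
  shows "G g = 0"
proof -
  let ?l = "\<lambda>t. g + mconst t * (f + mconst (- 1) * g)"
  obtain p q where p: "\<And>t. F (?l t) = poly p t" and q: "\<And>t. G (?l t) = poly q t"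
    using assms(1,2) unfolding poly_fun_def by meson
  have "poly (p * q) t = 0" for t
    unfolding poly_mult p[symmetric] q[symmetric]
    by (intro FG ternary_cubic_form_add ternary_cubic_form_mconst_mult f g)
  then have "p * q = 0"
    using poly_all_0_iff_0 by blast
  moreover have "poly p 1 \<noteq> 0"
    using p[of 1] f(2) by (simp add: mconst_1 mconst_uminus)
  ultimately have "q = 0" by auto
  then show ?thesis
    using q[of 0] by (simp add: mconst_0)
qed

lemma invariants_eq_jacobian:
  assumes inv: "ternary_cubic_invariants inv_I inv_J" and f: "ternary_cubic_form f"
  shows "16 * value_at inv_I f = jacobian_c4 f" "32 * value_at inv_J f = jacobian_c6 f"
proof -
  \<comment> \<open>The coefficients of \<open>x\<^sup>3\<close> and \<open>y\<^sup>3\<close> in the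
    Hessian, written out as polynomials in the coefficients so that they are visibly instances of
    \<open>poly_fun\<close>.\<close>
  define H3 H2 :: "(3, rat) mpolynomial \<Rightarrow> rat" where
    "H3 = (\<lambda>f. 24 * coef f 3 0 0 * coef f 1 2 0 * coef f 1 0 2
      - 6 * coef f 3 0 0 * coef f 1 1 1 ^ 2 - 8 * coef f 2 1 0 ^ 2 * coef f 1 0 2
        + 8 * coef f 2 1 0 * coef f 2 0 1 * coef f 1 1 1 - 8 * coef f 2 0 1 ^ 2 * coef f 1 2 0)" and
    "H2 = (\<lambda>f. 24 * coef f 0 3 0 * coef f 2 1 0 * coef f 0 1 2
      - 6 * coef f 0 3 0 * coef f 1 1 1 ^ 2 - 8 * coef f 2 1 0 * coef f 0 2 1 ^ 2
        - 8 * coef f 1 2 0 ^ 2 * coef f 0 1 2 + 8 * coef f 1 2 0 * coef f 0 2 1 * coef f 1 1 1)"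
  have rel: "48 * jacobian_c4 f ^ 2 * coef f 3 0 0 + 16 * jacobian_c6 f * H3 f =
        12288 * value_at inv_I f ^ 2 * coef f 3 0 0 + 512 * value_at inv_J f * H3 f"
      "48 * jacobian_c4 f ^ 2 * coef f 0 3 0 + 16 * jacobian_c6 f * H2 f =
        12288 * value_at inv_I f ^ 2 * coef f 0 3 0 + 512 * value_at inv_J f * H2 f"
    if f: "ternary_cubic_form f" for f
  proof -
    have H: "coef (hessian f) 3 0 0 = H3 f" "coef (hessian f) 0 3 0 = H2 f"
      unfolding H3_def H2_def by (rule coef_hessian[OF f])+
    have "hessian (hessian f) =
        mconst (12288 * (value_at inv_I f)\<^sup>2) * f + mconst (512 * value_at inv_J f) * hessian f"
      using inv f unfolding ternary_cubic_invariants_def by blast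
    then have "coef (hessian (hessian f)) i j k =
        12288 * value_at inv_I f ^ 2 * coef f i j k
        + 512 * value_at inv_J f * coef (hessian f) i j k" for i j k
      by (simp add: coef_def lookup_add lookup_mconst_mult)
    from this[of 3 0 0] this[of 0 3 0] hessian_hessian_coef[OF f] show
      "48 * jacobian_c4 f ^ 2 * coef f 3 0 0 + 16 * jacobian_c6 f * H3 f =
        12288 * value_at inv_I f ^ 2 * coef f 3 0 0 + 512 * value_at inv_J f * H3 f"
      "48 * jacobian_c4 f ^ 2 * coef f 0 3 0 + 16 * jacobian_c6 f * H2 f =
        12288 * value_at inv_I f ^ 2 * coef f 0 3 0 + 512 * value_at inv_J f * H2 f"
      unfolding H by simp_all
  qed
  have J: "32 * value_at inv_J f - jacobian_c6 f = 0" if f: "ternary_cubic_form f" for f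
  proof (rule poly_fun_cancel[OF _ _ _ ternary_cubic_form_cubic_form _ f])
    \<comment> \<open>Up to sign, \<open>?F\<close> is the determinant of the two equations in
      \<open>rel\<close>, regarded as linear in the differences of the squares and of the sextic
      invariants. On \<open>x\<^sup>3 + x\<^sup>2 y + y\<^sup>2 z\<close> it equals 8.\<close>
    let ?F = "\<lambda>f. coef f 0 3 0 * H3 f - coef f 3 0 0 * H2 f"
    show "poly_fun ?F"
      unfolding H3_def H2_def coef_def by (intro poly_fun_intros)
    show "poly_fun (\<lambda>f. 32 * value_at inv_J f - jacobian_c6 f)"
      by (intro poly_fun_intros poly_fun_value_at poly_fun_jacobian)
    show "?F f * (32 * value_at inv_J f - jacobian_c6 f) = 0" if "ternary_cubic_form f" for f
      using rel[OF that] by algebra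
    show "?F (cubic_form 1 0 0 1 0 0 1 0 0 0) \<noteq> 0"
      unfolding H3_def H2_def coef_cubic_form by simp
  qed
  then show "32 * value_at inv_J f = jacobian_c6 f" using f by simp
  have "16 * value_at inv_I f - jacobian_c4 f = 0" 
  proof (rule poly_fun_cancel[OF _ _ _ ternary_cubic_form_cubic_form _ f])
    \<comment> \<open>With \<open>J\<close> known, the first equation of \<open>rel\<close> becomes
      a difference of squares times the coefficient of \<open>x\<^sup>3\<close>. The cofactor of the
      wanted difference is nonzero at the Weierstrass cubic with A = 1, B = 0, where both 16 I and
      \<open>c\<^sub>4\<close> are -48; here the sign normalization enters.\<close>
    let ?F = "\<lambda>f. coef f 3 0 0 * (16 * value_at inv_I f + jacobian_c4 f)"
    show "poly_fun ?F"
      unfolding coef_def by (intro poly_fun_intros poly_fun_value_at poly_fun_jacobian)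
    show "poly_fun (\<lambda>f. 16 * value_at inv_I f - jacobian_c4 f)"
      by (intro poly_fun_intros poly_fun_value_at poly_fun_jacobian)
    show "?F f * (16 * value_at inv_I f - jacobian_c4 f) = 0" if "ternary_cubic_form f" for f
      using rel(1)[OF that] J[OF that] by algebra
    have "value_at inv_I (cubic_form 1 0 0 0 0 0 (- 1) 1 0 0) = - 3"
      using inv unfolding ternary_cubic_invariants_def weierstrass_form_eq by fastforce
    moreover have "jacobian_c4 (cubic_form 1 0 0 0 0 0 (- 1) 1 0 0 :: (3, rat) mpolynomial) = - 48"
      unfolding jacobian_defs coef_cubic_form by simp
    ultimately show "?F (cubic_form 1 0 0 0 0 0 (- 1) 1 0 0) \<noteq> 0"
      by (simp add: coef_cubic_form)
  qed
  then show "16 * value_at inv_I f = jacobian_c4 f" by simp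
qed

section \<open>Congruences for the invariants of integral Weierstrass equations\<close>

definition kraus_at_2 :: "int \<Rightarrow> int \<Rightarrow> bool" where
  "kraus_at_2 a b \<longleftrightarrow>
     [a = 0] (mod 16) \<and> [b = 0] (mod 32) \<or> [a = 0] (mod 16) \<and> [b = 8] (mod 32) \<or>
     [a = 1] (mod 64) \<and> [b = 31] (mod 32) \<or> [a = 9] (mod 64) \<and> [b = 27] (mod 32) \<or>
     [a = 17] (mod 64) \<and> [b = 7] (mod 32) \<or> [a = 25] (mod 64) \<and> [b = 3] (mod 32) \<or>
     [a = 33] (mod 64) \<and> [b = 15] (mod 32) \<or> [a = 41] (mod 64) \<and> [b = 11] (mod 32) \<or>
     [a = 49] (mod 64) \<and> [b = 23] (mod 32) \<or> [a = 57] (mod 64) \<and> [b = 19] (mod 32)"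

text \<open>The residues are \<open>16\<close> and \<open>32\<close> times those prescribed for \<open>I\<close> and \<open>J\<close>.\<close>

definition kraus_at_3 :: "int \<Rightarrow> int \<Rightarrow> bool" where
  "kraus_at_3 a b \<longleftrightarrow>
     [a = 0] (mod 3) \<and> [b = 0] (mod 27) \<or>
     [a = 16] (mod 9) \<and> ([b = 64] (mod 27) \<or> [b = - 64] (mod 27)) \<or>
     [a = 64] (mod 9) \<and> ([b = 512] (mod 27) \<or> [b = - 512] (mod 27)) \<or>
     [a = 112] (mod 9) \<and> ([b = 224] (mod 27) \<or> [b = - 224] (mod 27))"

lemma kraus_at_2_cong:
  assumes "[a = a'] (mod 64)" "[b = b'] (mod 32)"
  shows "kraus_at_2 a b \<longleftrightarrow> kraus_at_2 a' b'"
proof -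
  have "[a = a'] (mod 16)"
    using assms(1) by (rule cong_dvd_modulus) simp
  with assms show ?thesis
    unfolding kraus_at_2_def cong_def by (simp only:)
qed

lemma kraus_at_3_cong:
  assumes "[a = a'] (mod 9)" "[b = b'] (mod 27)"
  shows "kraus_at_3 a b \<longleftrightarrow> kraus_at_3 a' b'"
proof -
  have "[a = a'] (mod 3)"
    using assms(1) by (rule cong_dvd_modulus) simp
  with assms show ?thesis
    unfolding kraus_at_3_def cong_def by (simp only:)
qed

text \<open>This is the case of odd \<open>a\<^sub>1\<close>, with \<open>s\<close>,
  \<open>w\<close> and \<open>w ^ 2 + 4 * j\<close> as \<open>b\<^sub>2\<close>,
  \<open>b\<^sub>4\<close> and \<open>b\<^sub>6\<close>. The relevant residues depend only on
  \<open>n\<close> and \<open>w\<close> modulo 8, since 864 = 27 * 32 removes \<open>j\<close>; the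
  64 remaining cases are evaluated.\<close>

lemma kraus_at_2_odd:
  fixes n w j :: int
  defines "s \<equiv> 4 * n + 1"
  shows "kraus_at_2 (s ^ 2 - 24 * w) (- (s ^ 3) + 36 * s * w - 216 * (w ^ 2 + 4 * j))"
proof -
  define r t where "r = n mod 8" and "t = w mod 8"
  obtain k l where n: "n = r + 8 * k" and w: "w = t + 8 * l"
    unfolding r_def t_def by (metis mod_div_mult_eq mult.commute)
  have "[s ^ 2 - 24 * w = (4 * r + 1) ^ 2 - 24 * t] (mod 64)"
    unfolding s_def n w cong_iff_dvd_diff
    by (rule dvdI[of _ _ "k * (4 * r + 1) + 16 * k ^ 2 - 3 * l"]) (simp add: algebra_simps power2_eq_square)
  moreover have "[- (s ^ 3) + 36 * s * w - 216 * (w ^ 2 + 4 * j) =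
      - ((4 * r + 1) ^ 3) + 36 * (4 * r + 1) * t - 216 * t ^ 2] (mod 32)"
  proof -
    \<comment> \<open>The factor 36 is kept with \<open>w\<close>: a change of \<open>w\<close> by 8
      alters 36 w, but not w itself, by a multiple of 32.\<close>
    have s: "[s = 4 * r + 1] (mod 32)" "[36 * w = 36 * t] (mod 32)" "[216 * w ^ 2 = 216 * t ^ 2] (mod 32)"
      unfolding s_def n w cong_iff_dvd_diff by (simp_all add: algebra_simps power2_eq_square)
    have "[- (s ^ 3) + s * (36 * w) - 216 * w ^ 2 - 864 * j =
        - ((4 * r + 1) ^ 3) + (4 * r + 1) * (36 * t) - 216 * t ^ 2 - 0] (mod 32)"
      by (intro cong_diff cong_add cong_mult cong_pow s cong_minus_minus_iff[THEN iffD2]) (simp add: cong_0_iff)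
    then show ?thesis by (simp add: algebra_simps)
  qed
  moreover have "kraus_at_2 ((4 * r + 1) ^ 2 - 24 * t)
      (- ((4 * r + 1) ^ 3) + 36 * (4 * r + 1) * t - 216 * t ^ 2)"
  proof -
    have "\<forall>r\<in>set [0..7]. \<forall>t\<in>set [0..7]. kraus_at_2 ((4 * r + 1) ^ 2 - 24 * t)
        (- ((4 * r + 1) ^ 3) + 36 * (4 * r + 1) * t - 216 * t ^ 2)"
      unfolding kraus_at_2_def cong_def by code_simp
    moreover have "r \<in> set [0..7]" "t \<in> set [0..7]" unfolding r_def t_def by auto
    ultimately show ?thesis by blast
  qed
  ultimately show ?thesis
    using kraus_at_2_cong by blast
qed

text \<open>At 3 the values of \<open>b\<^sub>2\<close>, \<open>b\<^sub>4\<close>,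
  \<open>b\<^sub>6\<close> may be arbitrary integers. As 216 = 8 * 27, only \<open>s\<close> modulo
  9 and \<open>w\<close> modulo 3 matter, which leaves 27 cases to evaluate.\<close>

lemma kraus_at_3_weierstrass:
  fixes s w v :: int
  shows "kraus_at_3 (s ^ 2 - 24 * w) (- (s ^ 3) + 36 * s * w - 216 * v)"
proof -
  define r t where "r = s mod 9" and "t = w mod 3"
  obtain k l where s: "s = r + 9 * k" and w: "w = t + 3 * l"
    unfolding r_def t_def by (metis mod_div_mult_eq mult.commute)
  have "[s ^ 2 - 24 * w = r ^ 2 - 24 * t] (mod 9)"
    unfolding s w cong_iff_dvd_diff
    by (rule dvdI[of _ _ "2 * r * k + 9 * k ^ 2 - 8 * l"]) (simp add: algebra_simps power2_eq_square)
  moreover have "[- (s ^ 3) + 36 * s * w - 216 * v = - (r ^ 3) + 36 * r * t] (mod 27)"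
    unfolding s w cong_iff_dvd_diff
    by (rule dvdI[of _ _ "- (r ^ 2 * k + 9 * r * k ^ 2 + 27 * k ^ 3) + 4 * r * l + 12 * k * t
      + 36 * k * l - 8 * v"])
      (simp add: algebra_simps power2_eq_square power3_eq_cube)
  moreover have "kraus_at_3 (r ^ 2 - 24 * t) (- (r ^ 3) + 36 * r * t)"
  proof -
    have "\<forall>r\<in>set [0..8]. \<forall>t\<in>set [0..2]. kraus_at_3 (r ^ 2
      - 24 * t) (- (r ^ 3) + 36 * r * t)"
      unfolding kraus_at_3_def cong_def by code_simp
    moreover have "r \<in> set [0..8]" "t \<in> set [0..2]" unfolding r_def t_def by auto
    ultimately show ?thesis by blast
  qed
  ultimately show ?thesis
    using kraus_at_3_cong by blast
qed

section \<open>How far the congruences determine one invariant from the other\<close>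

lemma kraus_at_2_cases:
  assumes "kraus_at_2 a b"
  shows "[a = 0] (mod 16) \<or> [a = 1] (mod 8)"
proof -
  have *: "a mod 8 = a mod 64 mod 8"
    by (simp add: mod_mod_cancel)
  from assms show ?thesis
    unfolding kraus_at_2_def cong_def * by auto
qed

text \<open>Each odd residue of \<open>a\<close> modulo 64 is listed with a single residue of
  \<open>b\<close>, whereas multiples of 16 allow two. Thus any candidate with the same odd
  \<open>a\<close> has the right \<open>b\<close> modulo 32.\<close>

lemma kraus_at_2_unique:
  assumes "kraus_at_2 a b" "kraus_at_2 a b'" "odd a"
  shows "[b = b'] (mod 32)"
proof -
  have "\<not> [a = 0] (mod 16)"
    using \<open>odd a\<close> by (auto simp: cong_0_iff dest: dvd_trans[of 2 16])
  with assms(1,2) show ?thesis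
    unfolding kraus_at_2_def by (auto simp: cong_def)
qed

text \<open>Given \<open>a\<close>, the residue of \<open>b\<close> modulo 27 is fixed up to sign.
  Unless it is 0 it is prime to 3, so the sign is visible modulo 3.\<close>

lemma kraus_at_3_unique:
  assumes "kraus_at_3 a b" "kraus_at_3 a b'" "[b = b'] (mod 3)"
  shows "[b = b'] (mod 27)"
proof -
  have *: "a mod 3 = a mod 9 mod 3" "b mod 3 = b mod 27 mod 3" "b' mod 3 = b' mod 27 mod 3"
    by (simp_all add: mod_mod_cancel)
  from assms show ?thesis
    unfolding kraus_at_3_def cong_def * by auto
qed

text \<open>Either 3 divides both numbers, or \<open>a\<close> is 1 modulo 3 and \<open>b\<close> is
  prime to 3. This lets an integer congruent to \<open>- b\<close> serve as a square root of
  \<open>a\<close> modulo 3.\<close>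

lemma kraus_at_3_square:
  assumes "kraus_at_3 a b"
  shows "[a = b ^ 2] (mod 3)"
proof -
  have *: "a mod 3 = a mod 9 mod 3" "b ^ 2 mod 3 = (b mod 27 mod 3) ^ 2 mod 3"
    by (simp_all add: mod_mod_cancel power_mod)
  from assms show ?thesis
    unfolding kraus_at_3_def cong_def * by auto
qed

lemma kraus_necessary:
  fixes a1 a2 a3 a4 a6 :: int
  defines "a \<equiv> weierstrass_c4 a1 a2 a3 a4" and "b \<equiv> weierstrass_c6 a1 a2 a3 a4 a6"
  shows "kraus_at_2 a b" "kraus_at_3 a b"
proof -
  show "kraus_at_3 a b"
    unfolding a_def b_def weierstrass_c4_def weierstrass_c6_def by (rule kraus_at_3_weierstrass)
  show "kraus_at_2 a b"
  proof (cases "even a1")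
    case True
    then obtain k where k: "a1 = 2 * k" by blast
    have "[a = 0] (mod 16)"
      unfolding a_def weierstrass_c4_def k cong_0_iff
      by (rule dvdI[of _ _ "(k ^ 2 + a2) ^ 2 - 3 * (a4 + k * a3)"]) (simp add: algebra_simps power2_eq_square)
    moreover have b: "[b = 8 * a3 ^ 2] (mod 32)"
      unfolding b_def weierstrass_c6_def k cong_iff_dvd_diff
      by (rule dvdI[of _ _ "- 2 * (k ^ 2 + a2) ^ 3 + 9 * (k ^ 2 + a2) * (a4 + k * a3)
        - 7 * a3 ^ 2 - 27 * a6"])
        (simp add: algebra_simps power2_eq_square power3_eq_cube)
    moreover have "[8 * a3 ^ 2 = 0] (mod 32) \<or> [8 * a3 ^ 2 = 8] (mod 32)"
    proof (cases "even a3")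
      case True
      then show ?thesis by (auto simp: cong_0_iff)
    next
      case False
      then obtain l where "a3 = 2 * l + 1" by (auto elim: oddE)
      then have "8 * a3 ^ 2 = 8 + 32 * (l ^ 2 + l)" by (simp add: algebra_simps power2_eq_square)
      then show ?thesis by (simp add: cong_iff_dvd_diff)
    qed
    ultimately show ?thesis
      unfolding kraus_at_2_def using cong_trans by blast
  next
    case False
    then obtain k where k: "a1 = 2 * k + 1" by (auto elim: oddE)
    \<comment> \<open>For odd \<open>a\<^sub>1\<close> the square \<open>a\<^sub>1\<^sup>2\<close>
      is 1 + 4 (k^2 + k), so \<open>b\<^sub>2\<close> is 1 modulo 4 and
      \<open>b\<^sub>6 - b\<^sub>4\<^sup>2\<close> is divisible by 4, with quotient
      \<open>j\<close>.\<close>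
    define n w where "n = k ^ 2 + k + a2" and "w = 2 * a4 + a1 * a3"
    define j where "j = a6 - a4 ^ 2 - a1 * a3 * a4 - (k ^ 2 + k) * a3 ^ 2"
    have "a1 ^ 2 + 4 * a2 = 4 * n + 1" "a3 ^ 2 + 4 * a6 = w ^ 2 + 4 * j"
      unfolding n_def w_def j_def k by (simp_all add: algebra_simps power2_eq_square)
    then show ?thesis
      unfolding a_def b_def weierstrass_c4_def weierstrass_c6_def w_def[symmetric]
      using kraus_at_2_odd by simp
  qed
qed

text \<open>Take \<open>a\<^sub>1 = e\<close> and \<open>a\<^sub>3 = d\<close>. The congruences are
  then solvable for \<open>a\<^sub>2\<close>, \<open>a\<^sub>6\<close>, \<open>a\<^sub>4\<close> in
  the definitions of \<open>b\<^sub>2\<close>, \<open>b\<^sub>6\<close>, \<open>b\<^sub>4\<close>,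
  because \<open>e\<close> and \<open>d\<close> equal their squares.\<close>

lemma weierstrass_exists:
  fixes s w v e d :: int
  assumes "[s = e] (mod 4)" "[v = d] (mod 4)" "[w = e * d] (mod 2)" "e ^ 2 = e" "d ^ 2 = d"
  shows "\<exists>a1 a2 a3 a4 a6. s ^ 2 - 24 * w = weierstrass_c4 a1 a2 a3 a4 \<and>
    - (s ^ 3) + 36 * s * w - 216 * v = weierstrass_c6 a1 a2 a3 a4 a6"
proof -
  obtain a2 a4 a6 where "s = e + 4 * a2" "v = d + 4 * a6" "w = e * d + 2 * a4"
    using assms(1-3) by (metis cong_iff_lin cong_sym)
  with assms(4,5) have "s = e ^ 2 + 4 * a2" "v = d ^ 2 + 4 * a6" "w = 2 * a4 + e * d" by simp_all
  then show ?thesis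
    unfolding weierstrass_c4_def weierstrass_c6_def by blast
qed

text \<open>First \<open>s\<close> is chosen with square \<open>a\<close> modulo 24, which yields
  \<open>w\<close>; then \<open>v\<close> is chosen to match \<open>b\<close> modulo 32. Agreement
  modulo 27 follows, and the remaining error, a multiple of 864 = 4 * 216, is absorbed by a change
  of \<open>v\<close> that keeps its class modulo 4.\<close>

lemma kraus_sufficient:
  fixes a b :: int
  assumes "kraus_at_2 a b" "kraus_at_3 a b"
  shows "\<exists>a1 a2 a3 a4 a6. a = weierstrass_c4 a1 a2 a3 a4 \<and> b = weierstrass_c6 a1 a2 a3 a4 a6"
proof -
  \<comment> \<open>\<open>e, s, w, v\<close> play the roles of \<open>a\<^sub>1\<close>, \<open>b\<^sub>2 = a\<^sub>1\<^sup>2 + 4 a\<^sub>2\<close>, \<open>b\<^sub>4\<close>, \<open>b\<^sub>6\<close>; only \<open>b\<^sub>2\<close> modulo 12 matters, and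
    it is forced by \<open>b\<^sub>2 \<equiv> - c\<^sub>6 (mod 3)\<close> and \<open>b\<^sub>2 \<equiv> a\<^sub>1 (mod 4)\<close>.\<close>
  define e where "e = a mod 2"
  define s where "s = e - 4 * (b + e)"
  have e: "e = 0 \<or> e = 1" unfolding e_def by auto
  then have "e ^ 2 = e" by auto
  have a8: "[a = e] (mod 8)" "even a \<Longrightarrow> [a = 0] (mod 16)"
  proof -
    have "[a = 0] (mod 16) \<or> [a = 1] (mod 8)"
      by (rule kraus_at_2_cases[OF assms(1)])
    moreover have "even a" if "[a = 0] (mod 16)"
      using that by (auto simp: cong_0_iff dest: dvd_trans[of 2 16])
    moreover have "odd a" if "[a = 1] (mod 8)"
      using cong_dvd_modulus[OF that, of 2] by (simp add: cong_def odd_iff_mod_2_eq_one)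
    moreover have "[a = 0] (mod 8)" if "[a = 0] (mod 16)"
      using that by (rule cong_dvd_modulus) simp
    ultimately show "[a = e] (mod 8)" "even a \<Longrightarrow> [a = 0] (mod 16)"
      unfolding e_def by (auto simp: odd_iff_mod_2_eq_one even_iff_mod_2_eq_zero)
  qed
  have s3: "[- s = b] (mod 3)"
    unfolding s_def cong_iff_dvd_diff by (rule dvdI[of _ _ "b + e"]) simp
  have "[s ^ 2 = a] (mod 24)"
  proof -
    have "[s ^ 2 = a] (mod 3)"
      using cong_pow[OF s3, of 2] kraus_at_3_square[OF assms(2)] by (auto intro: cong_trans cong_sym)
    moreover have "[s ^ 2 = e ^ 2] (mod 8)"
      unfolding s_def cong_iff_dvd_diff
      by (rule dvdI[of _ _ "- e * (b + e) + 2 * (b + e) ^ 2"]) (simp add: algebra_simps power2_eq_square)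
    then have "[s ^ 2 = a] (mod 8)"
      using a8(1) \<open>e ^ 2 = e\<close> by (metis cong_sym cong_trans)
    moreover have "24 dvd x" if "3 dvd x" "8 dvd x" for x :: int
      using that by presburger
    ultimately show ?thesis
      unfolding cong_iff_dvd_diff by blast
  qed
  then obtain w where "s ^ 2 - a = 24 * w"
    unfolding cong_iff_dvd_diff by blast
  then have w: "a = s ^ 2 - 24 * w" by simp
  have "\<exists>v d. [b = - (s ^ 3) + 36 * s * w - 216 * v] (mod 32) \<and> [v = d] (mod 4) \<and>
      [w = e * d] (mod 2) \<and> d ^ 2 = d"
  proof (cases "e = 0")
    case True
    then have "even a" unfolding e_def by auto
    then have "[a = 0] (mod 16)" by (rule a8(2))
    moreover have s: "s = - 4 * b" using True unfolding s_def by simp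
    ultimately have "16 dvd 24 * w"
      unfolding w cong_0_iff by (simp add: power_mult_distrib dvd_diff_right_iff)
    then have "even w" by presburger
    then obtain l where l: "w = 2 * l" by blast
    \<comment> \<open>For \<open>16 dvd a\<close> the residue of \<open>b\<close> modulo 32 is 0 or
      8. Here the terms in \<open>s\<close> vanish modulo 32 and -216 is congruent to 8, so
      \<open>v = d\<close> with d = 0 or 1 realizes it.\<close>
    define d :: int where "d = (if [b = 0] (mod 32) then 0 else 1)"
    have "[b = 8 * d] (mod 32)"
      using assms(1) \<open>[a = 0] (mod 16)\<close> \<open>even a\<close> unfolding kraus_at_2_def d_def
      by (auto simp: cong_def) presburger+
    moreover have "[8 * d = - (s ^ 3) + 36 * s * w - 216 * d] (mod 32)"
      unfolding s l cong_iff_dvd_diff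
      by (rule dvdI[of _ _ "- 2 * b ^ 3 + 9 * b * l + 7 * d"]) (simp add: algebra_simps power3_eq_cube)
    moreover have "d ^ 2 = d" unfolding d_def by simp
    ultimately show ?thesis
      using \<open>even w\<close> True cong_trans by (intro exI[of _ d]) (auto simp: cong_0_iff)
  next
    case False
    with e have "e = 1" by simp
    then have "odd a" unfolding e_def by presburger
    have s: "s = 4 * (- b - 1) + 1" using \<open>e = 1\<close> unfolding s_def by simp
    \<comment> \<open>With \<open>a\<^sub>1 = 1\<close> the value \<open>b\<^sub>6\<close> must be
      congruent to \<open>b\<^sub>4\<^sup>2\<close> modulo 4. The choice \<open>v = w ^ 2\<close>
      meets this, and uniqueness for odd \<open>a\<close> gives the congruence for
      \<open>b\<close>.\<close>
    have "kraus_at_2 a (- (s ^ 3) + 36 * s * w - 216 * (w ^ 2))"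
      using kraus_at_2_odd[of "- b - 1" w 0] unfolding w s by simp
    with assms(1) have "[b = - (s ^ 3) + 36 * s * w - 216 * (w ^ 2)] (mod 32)"
      using \<open>odd a\<close> by (rule kraus_at_2_unique)
    moreover have "[w ^ 2 = w mod 2] (mod 4)"
    proof (cases "even w")
      case True
      then show ?thesis by (auto simp: cong_0_iff)
    next
      case False
      then obtain l where "w = 2 * l + 1" by (auto elim: oddE)
      then have "w ^ 2 = 1 + 4 * (l ^ 2 + l)" "w mod 2 = 1" by (simp_all add: algebra_simps power2_eq_square)
      then show ?thesis by (simp add: cong_iff_dvd_diff)
    qed
    moreover have "(w mod 2) ^ 2 = w mod 2" by (metis not_mod_2_eq_0_eq_1 one_power2 zero_power2)
    ultimately show ?thesis
      using \<open>e = 1\<close> by (intro exI[of _ "w ^ 2"] exI[of _ "w mod 2"]) (simp add: cong_def)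
  qed
  then obtain v d where v: "[b = - (s ^ 3) + 36 * s * w - 216 * v] (mod 32)" "[v = d] (mod 4)"
    "[w = e * d] (mod 2)" "d ^ 2 = d" by blast
  let ?b = "- (s ^ 3) + 36 * s * w - 216 * v"
  \<comment> \<open>Both numbers are paired with the same \<open>a\<close>, so comparison modulo 3
    suffices; there \<open>?b\<close> reduces to \<open>- (s ^ 3)\<close>, which is
    \<open>- s\<close> by Fermat and hence \<open>b\<close>.\<close>
  have "[b = ?b] (mod 27)"
  proof (rule kraus_at_3_unique[OF assms(2)])
    show "kraus_at_3 a ?b" unfolding w by (rule kraus_at_3_weierstrass)
    have "[- (s ^ 3) = - s] (mod 3)"
    proof -
      have "s mod 3 \<in> {0, 1, 2}" by auto
      moreover have "s ^ 3 mod 3 = (s mod 3) ^ 3 mod 3" by (simp add: power_mod)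
      ultimately have "[s ^ 3 = s] (mod 3)" unfolding cong_def by auto
      then show ?thesis by (simp only: cong_minus_minus_iff)
    qed
    moreover have "[?b = - (s ^ 3)] (mod 3)"
      unfolding cong_iff_dvd_diff by (rule dvdI[of _ _ "12 * s * w - 72 * v"]) simp
    ultimately show "[b = ?b] (mod 3)"
      using s3 by (meson cong_sym cong_trans)
  qed
  moreover have "864 dvd x" if "32 dvd x" "27 dvd x" for x :: int
    using that by presburger
  ultimately obtain j where "b - ?b = 864 * j"
    using v(1) unfolding cong_iff_dvd_diff by (meson dvdE)
  then have j: "b = ?b + 864 * j" by simp
  have "[v - 4 * j = d] (mod 4)"
    using v(2) unfolding cong_iff_dvd_diff by presburger
  moreover have "[s = e] (mod 4)"
    unfolding s_def by (simp add: cong_iff_dvd_diff)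
  ultimately have "\<exists>a1 a2 a3 a4 a6. s ^ 2 - 24 * w = weierstrass_c4 a1 a2 a3 a4 \<and>
      - (s ^ 3) + 36 * s * w - 216 * (v - 4 * j) = weierstrass_c6 a1 a2 a3 a4 a6"
    using v(3,4) \<open>e ^ 2 = e\<close> by (intro weierstrass_exists)
  moreover have "b = - (s ^ 3) + 36 * s * w - 216 * (v - 4 * j)"
    using j by simp
  ultimately show ?thesis
    using w by (simp only:)
qed

text \<open>As \<open>n\<close> is a unit at 3, the congruence may be multiplied by it. Forwards,
  the denominator \<open>v\<close> is coprime to \<open>3 ^ e\<close> and cancels; backwards,
  \<open>n\<close> itself serves as denominator.\<close>

lemma cong_at_3_iff:
  fixes a k n :: int
  assumes n: "\<not> 3 dvd n"
  shows "cong_at_3 (of_int a / of_int n) (of_int k) (3 ^ e) \<longleftrightarrow> [a = n * k] (mod 3 ^ e)"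
proof
  have "n \<noteq> 0" using n by auto
  {
    assume "cong_at_3 (of_int a / of_int n) (of_int k) (3 ^ e)"
    then obtain u v where v: "\<not> 3 dvd v"
      and eq: "of_int a / of_int n - of_int k = rat_of_int (3 ^ e) * (rat_of_int u / rat_of_int v)"
      unfolding cong_at_3_def by blast
    have "v \<noteq> 0" using v by auto
    with eq \<open>n \<noteq> 0\<close> have "rat_of_int ((a - n * k) * v) = rat_of_int (3 ^ e * (n * u))"
      by (simp add: field_simps)
    then have "3 ^ e dvd (a - n * k) * v"
      unfolding of_int_eq_iff by simp
    moreover have "coprime (3 ^ e) v"
      using v prime_imp_coprime[of 3 v] by (simp add: coprime_power_left_iff)
    ultimately show "[a = n * k] (mod 3 ^ e)"
      unfolding cong_iff_dvd_diff using coprime_dvd_mult_left_iff by blast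
  next
    assume "[a = n * k] (mod 3 ^ e)"
    then obtain u where "a - n * k = 3 ^ e * u"
      unfolding cong_iff_dvd_diff by (elim dvdE)
    then have "rat_of_int a = of_int n * of_int k + 3 ^ e * of_int u"
      by (metis diff_eq_eq add.commute of_int_add of_int_mult of_int_power of_int_numeral)
    then have "of_int a / of_int n - of_int k = rat_of_int (3 ^ e) * (rat_of_int u / rat_of_int n)"
      using \<open>n \<noteq> 0\<close> by (simp add: field_simps)
    then show "cong_at_3 (of_int a / of_int n) (of_int k) (3 ^ e)"
      unfolding cong_at_3_def using n by blast
  }
qed

lemma kraus_at_3_iff:
  fixes a b :: int and I J :: rat
  assumes "I = of_int a / 16" "J = of_int b / 32"
  shows "kraus_at_3 a b \<longleftrightarrow>
     (cong_at_3 I 0 3 \<and> cong_at_3 J 0 27 \<or>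
      cong_at_3 I 1 9 \<and> (cong_at_3 J 2 27 \<or> cong_at_3 J (- 2) 27) \<or>
      cong_at_3 I 4 9 \<and> (cong_at_3 J 16 27 \<or> cong_at_3 J (- 16) 27) \<or>
      cong_at_3 I 7 9 \<and> (cong_at_3 J 7 27 \<or> cong_at_3 J (- 7) 27))"
proof -
  have I: "cong_at_3 I (of_int k) (3 ^ e) \<longleftrightarrow> [a = 16 * k] (mod 3 ^ e)" for k e
    using cong_at_3_iff[of 16 a k e] unfolding assms by simp
  have J: "cong_at_3 J (of_int k) (3 ^ e) \<longleftrightarrow> [b = 32 * k] (mod 3 ^ e)" for k e
    using cong_at_3_iff[of 32 b k e] unfolding assms by simp
  show ?thesis
    unfolding kraus_at_3_def
    using I[of 0 1] I[of 1 2] I[of 4 2] I[of 7 2] J[of 0 3] J[of 2 3] J[of "- 2" 3] J[of 16 3]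
      J[of "- 16" 3] J[of 7 3] J[of "- 7" 3]
    by simp
qed

lemma integral_invariants_iff:
  fixes a b :: int
  shows "(\<exists>f :: (3, int) mpolynomial. ternary_cubic_form f \<and> jacobian_c4 f = a \<and> jacobian_c6 f = b)
    \<longleftrightarrow> kraus_at_2 a b \<and> kraus_at_3 a b"
proof
  assume "\<exists>f :: (3, int) mpolynomial. ternary_cubic_form f \<and> jacobian_c4 f = a \<and> jacobian_c6 f = b"
  then show "kraus_at_2 a b \<and> kraus_at_3 a b"
    unfolding jacobian_c4_def jacobian_c6_def Let_def using kraus_necessary by blast
next
  assume "kraus_at_2 a b \<and> kraus_at_3 a b"
  then obtain a1 a2 a3 a4 a6 where ab: "a = weierstrass_c4 a1 a2 a3 a4" "b = weierstrass_c6 a1 a2 a3 a4 a6"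
    using kraus_sufficient by blast
  \<comment> \<open>The homogenized Weierstrass equation with y replaced by -y, which makes the
    formulas for the Jacobian return exactly the given coefficients.\<close>
  let ?f = "cubic_form 1 0 a6 0 a2 0 (- 1) a4 a3 a1"
  have "jacobian_c4 ?f = a" "jacobian_c6 ?f = b"
    unfolding ab jacobian_defs coef_cubic_form by simp_all
  then show "\<exists>f :: (3, int) mpolynomial. ternary_cubic_form f \<and> jacobian_c4 f = a \<and> jacobian_c6 f = b"
    using ternary_cubic_form_cubic_form by blast
qed

theorem theorem1p9:
  fixes inv_I inv_J :: coeff_polynomial and I J :: rat
  assumes "ternary_cubic_invariants inv_I inv_J"
  shows "(\<exists>f :: (3, int) mpolynomial. ternary_cubic_form f \<and>
            value_at inv_I (rational_form f) = I \<and> value_at inv_J (rational_form f) = J)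
     \<longleftrightarrow>
     (\<exists>a b :: int. I = of_int a / 16 \<and> J = of_int b / 32 \<and>
        ([a = 0] (mod 16) \<and> [b = 0] (mod 32) \<or>
         [a = 0] (mod 16) \<and> [b = 8] (mod 32) \<or>
         [a = 1] (mod 64) \<and> [b = 31] (mod 32) \<or>
         [a = 9] (mod 64) \<and> [b = 27] (mod 32) \<or>
         [a = 17] (mod 64) \<and> [b = 7] (mod 32) \<or>
         [a = 25] (mod 64) \<and> [b = 3] (mod 32) \<or>
         [a = 33] (mod 64) \<and> [b = 15] (mod 32) \<or>
         [a = 41] (mod 64) \<and> [b = 11] (mod 32) \<or>
         [a = 49] (mod 64) \<and> [b = 23] (mod 32) \<or>
         [a = 57] (mod 64) \<and> [b = 19] (mod 32))) \<and>
     (cong_at_3 I 0 3 \<and> cong_at_3 J 0 27 \<or>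
      cong_at_3 I 1 9 \<and> (cong_at_3 J 2 27 \<or> cong_at_3 J (- 2) 27) \<or>
      cong_at_3 I 4 9 \<and> (cong_at_3 J 16 27 \<or> cong_at_3 J (- 16) 27) \<or>
      cong_at_3 I 7 9 \<and> (cong_at_3 J 7 27 \<or> cong_at_3 J (- 7) 27))"
proof -
  have "(\<exists>f :: (3, int) mpolynomial. ternary_cubic_form f \<and>
      value_at inv_I (rational_form f) = I \<and> value_at inv_J (rational_form f) = J) \<longleftrightarrow>
    (\<exists>a b. I = of_int a / 16 \<and> J = of_int b / 32 \<and>
      (\<exists>f :: (3, int) mpolynomial. ternary_cubic_form f \<and> jacobian_c4 f = a \<and> jacobian_c6 f = b))"
  proof -
    have "value_at inv_I (rational_form f) = of_int (jacobian_c4 f) / 16 \<and>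
        value_at inv_J (rational_form f) = of_int (jacobian_c6 f) / 32"
      if "ternary_cubic_form f" for f :: "(3, int) mpolynomial"
      using invariants_eq_jacobian[OF assms rational_form_cubic[OF that]]
      unfolding jacobian_rational_form by simp
    then show ?thesis by metis
  qed
  also have "\<dots> \<longleftrightarrow> (\<exists>a b. I = of_int a / 16 \<and> J = of_int b / 32 \<and> kraus_at_2 a b \<and> kraus_at_3 a b)"
    unfolding integral_invariants_iff ..
  \<comment> \<open>The conditions at 3 are expressed through \<open>I\<close> and \<open>J\<close>
    alone, so they can leave the existential quantifier.\<close>
  also have "\<dots> \<longleftrightarrow> (\<exists>a b. I = of_int a / 16 \<and> J = of_int b / 32 \<and> kraus_at_2 a b) \<and>
     (cong_at_3 I 0 3 \<and> cong_at_3 J 0 27 \<or>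
      cong_at_3 I 1 9 \<and> (cong_at_3 J 2 27 \<or> cong_at_3 J (- 2) 27) \<or>
      cong_at_3 I 4 9 \<and> (cong_at_3 J 16 27 \<or> cong_at_3 J (- 16) 27) \<or>
      cong_at_3 I 7 9 \<and> (cong_at_3 J 7 27 \<or> cong_at_3 J (- 7) 27))"
    using kraus_at_3_iff by blast
  finally show ?thesis
    unfolding kraus_at_2_def .
qed

end
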